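(* Consider the CTH-RV car-following system with parameter vector $\theta=(k_1,k_2,\tau)\in\Theta=\{(k_1,k_2,\tau)\in\mathbb{R}^3: k_1\ge 0,\ k_2\ge 0\}$, initial condition $x_0=(s_0,v_0)\in\mathbb{R}^2$ and scalar input $u$: $$\dot s(t)=u(t)-v(t),\qquad \dot v(t)=k_1\bigl(s(t)-\tau v(t)\bigr)+k_2\bigl(u(t)-v(t)\bigr),\qquad s(0)=s_0,\ v(0)=v_0,$$ with output $y(t,\theta,x_0,u)=s(t)$. Let $x_0=(s_0,v_0)$ with $s_0\neq 0$, $v_0\neq 0$, and let $\theta=(k_1,k_2,\tau)\in\Theta$ satisfy $\tau=\dfrac{s_0}{v_0}$ and $k_2=\dfrac{v_0}{s_0}$. Then no admissible input exists: for every polynomial input $u$, every neighborhood of $\theta$ in $\Theta$ contains two distinct parameter vectors $\theta_1\neq\theta_2$ with $$y(t,\theta_1,x_0,u)=y(t,\theta_2,x_0,u)\quad\text{for all } t>0 .$$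
   Context: The CTH-RV (constant-time headway relative-velocity) model describes a vehicle following a leader: $s$ is the space gap, $v$ the follower's velocity, and the input $u$ the leader's velocity. The gains $k_1,k_2$ are non-negative and $\tau$ is the constant time headway; the parameters do not vary in time. Only the space gap is measured. Admissible inputs are polynomial inputs (real polynomials in $t$, of any degree) for which the system is locally identifiable at $\theta$, i.e. for which there is a neighborhood $\mathcal N(\theta)$ such that for $\theta_1,\theta_2\in\mathcal N(\theta)$, equality of the outputs for all $t>0$ (same $x_0$, same $u$) implies $\theta_1=\theta_2$. Neighborhoods are taken in $\Theta$ with the subspace topology. The initial condition need not be an equilibrium (in general $v_0\neq u(0)$). *)

theory Defs
  imports "HOL-Analysis.Analysis" "HOL-Computational_Algebra.Polynomial"
begin

type_synonym param = "real \<times> real \<times> real"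

definition Theta :: "param set" where
  "Theta = {(k1, k2, \<tau>). 0 \<le> k1 \<and> 0 \<le> k2}"

text \<open>At \<open>t = 0\<close> the derivatives below are one-sided; values of \<open>s\<close> and \<open>v\<close> at negative times
  are unconstrained.\<close>

definition cth_rv_solution ::
  "param \<Rightarrow> real \<times> real \<Rightarrow> (real \<Rightarrow> real) \<Rightarrow> (real \<Rightarrow> real) \<Rightarrow> (real \<Rightarrow> real) \<Rightarrow> bool" where
  "cth_rv_solution = (\<lambda>(k1, k2, \<tau>) (s0, v0) u s v.
     s 0 = s0 \<and> v 0 = v0 \<and>
     (\<forall>t\<ge>0. (s has_real_derivative (u t - v t)) (at t within {0..}) \<and>
            (v has_real_derivative (k1 * (s t - \<tau> * v t) + k2 * (u t - v t))) (at t within {0..})))"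

text \<open>The description is proper for polynomial \<open>u\<close> and \<open>t \<ge> 0\<close>; see \<open>cth_rv_output_unique\<close> below.\<close>

definition cth_rv_output :: "real \<Rightarrow> param \<Rightarrow> real \<times> real \<Rightarrow> (real \<Rightarrow> real) \<Rightarrow> real" where
  "cth_rv_output t \<theta> x0 u = (THE y. \<exists>s v. cth_rv_solution \<theta> x0 u s v \<and> y = s t)"

definition param_neighborhood :: "param set \<Rightarrow> param \<Rightarrow> bool" where
  "param_neighborhood N \<theta> \<longleftrightarrow>
     N \<subseteq> Theta \<and> (\<exists>U. openin (top_of_set Theta) U \<and> \<theta> \<in> U \<and> U \<subseteq> N)"

definition locally_identifiable :: "param \<Rightarrow> real \<times> real \<Rightarrow> (real \<Rightarrow> real) \<Rightarrow> bool" where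
  "locally_identifiable \<theta> x0 u \<longleftrightarrow>
     (\<exists>N. param_neighborhood N \<theta> \<and>
          (\<forall>\<theta>1\<in>N. \<forall>\<theta>2\<in>N.
             (\<forall>t>0. cth_rv_output t \<theta>1 x0 u = cth_rv_output t \<theta>2 x0 u) \<longrightarrow> \<theta>1 = \<theta>2))"

definition admissible_input :: "param \<Rightarrow> real \<times> real \<Rightarrow> (real \<Rightarrow> real) \<Rightarrow> bool" where
  "admissible_input \<theta> x0 u \<longleftrightarrow> (\<exists>p :: real poly. u = poly p) \<and> locally_identifiable \<theta> x0 u"


subsection \<open>Well-definedness of the output\<close>

text \<open>Taylor coefficients (scaled by factorials) of the solution for a polynomial input.\<close>

primrec cth_rv_taylor :: "param \<Rightarrow> real \<times> real \<Rightarrow> real poly \<Rightarrow> nat \<Rightarrow> real \<times> real" where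
  "cth_rv_taylor \<theta> x0 p 0 = x0"
| "cth_rv_taylor \<theta> x0 p (Suc n) =
     (case \<theta> of (k1, k2, \<tau>) \<Rightarrow> case cth_rv_taylor \<theta> x0 p n of (a, b) \<Rightarrow>
        (fact n * coeff p n - b, k1 * (a - \<tau> * b) + k2 * (fact n * coeff p n - b)))"

lemma cth_rv_solution_exists:
  "\<exists>s v. cth_rv_solution \<theta> x0 (poly p) s v"
proof -
  obtain k1 k2 \<tau> where th: "\<theta> = (k1, k2, \<tau>)" by (cases \<theta>) auto
  obtain s0 v0 where x0: "x0 = (s0, v0)" by (cases x0) auto
  define c where "c n = fact n * coeff p n" for n
  define A where "A n = fst (cth_rv_taylor \<theta> x0 p n)" for n
  define B where "B n = snd (cth_rv_taylor \<theta> x0 p n)" for n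
  have A0: "A 0 = s0" and B0: "B 0 = v0" by (simp_all add: A_def B_def x0)
  have AS: "A (Suc n) = c n - B n" for n
    by (simp add: A_def B_def c_def th split: prod.splits)
  have BS: "B (Suc n) = k1 * (A n - \<tau> * B n) + k2 * (c n - B n)" for n
    by (simp add: A_def B_def c_def th split: prod.splits)
  define K where "K = (\<Sum>n\<le>degree p. \<bar>c n\<bar>)"
  have K0: "K \<ge> 0" by (simp add: K_def sum_nonneg)
  have cK: "\<bar>c n\<bar> \<le> K" for n
  proof (cases "n \<le> degree p")
    case True
    then show ?thesis unfolding K_def by (intro member_le_sum) auto
  next
    case False
    then have "c n = 0" by (simp add: c_def coeff_eq_0)
    then show ?thesis using K0 by simp
  qed
  define M where "M = 2 + \<bar>k1\<bar> + \<bar>k1 * \<tau>\<bar> + \<bar>k2\<bar>"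
  define L where "L n = \<bar>A n\<bar> + \<bar>B n\<bar> + K" for n
  have M0: "M \<ge> 0" by (simp add: M_def)
  have LS: "L (Suc n) \<le> M * L n" for n
  proof -
    have 1: "\<bar>c n - B n\<bar> \<le> K + \<bar>B n\<bar>" using cK[of n] by linarith
    have 2: "\<bar>k1 * (A n - \<tau> * B n)\<bar> \<le> \<bar>k1\<bar> * \<bar>A n\<bar> + \<bar>k1 * \<tau>\<bar> * \<bar>B n\<bar>"
      using abs_triangle_ineq4[of "k1 * A n" "k1 * \<tau> * B n"]
      by (simp add: abs_mult algebra_simps)
    have 3: "\<bar>k2 * (c n - B n)\<bar> \<le> \<bar>k2\<bar> * (K + \<bar>B n\<bar>)"
      using mult_left_mono[OF 1, of "\<bar>k2\<bar>"] by (simp add: abs_mult)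
    have "L (Suc n) \<le> (K + \<bar>B n\<bar>) + (\<bar>k1\<bar> * \<bar>A n\<bar> + \<bar>k1 * \<tau>\<bar> * \<bar>B n\<bar> + \<bar>k2\<bar> * (K + \<bar>B n\<bar>)) + K"
      unfolding L_def AS BS using 1 2 3 by linarith
    also have "\<dots> \<le> M * L n"
    proof -
      have "0 \<le> \<bar>k1\<bar> * \<bar>B n\<bar>" "0 \<le> \<bar>k1\<bar> * K" "0 \<le> \<bar>k1 * \<tau>\<bar> * \<bar>A n\<bar>" "0 \<le> \<bar>k1 * \<tau>\<bar> * K"
           "0 \<le> \<bar>k2\<bar> * \<bar>A n\<bar>" "0 \<le> \<bar>A n\<bar>" "0 \<le> \<bar>B n\<bar>"
        using K0 by simp_all
      moreover have "M * L n = 2 * \<bar>A n\<bar> + 2 * \<bar>B n\<bar> + 2 * K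
          + \<bar>k1\<bar> * \<bar>A n\<bar> + \<bar>k1\<bar> * \<bar>B n\<bar> + \<bar>k1\<bar> * K
          + \<bar>k1 * \<tau>\<bar> * \<bar>A n\<bar> + \<bar>k1 * \<tau>\<bar> * \<bar>B n\<bar> + \<bar>k1 * \<tau>\<bar> * K
          + \<bar>k2\<bar> * \<bar>A n\<bar> + \<bar>k2\<bar> * \<bar>B n\<bar> + \<bar>k2\<bar> * K"
        unfolding M_def L_def by (simp add: algebra_simps)
      moreover have "\<bar>k2\<bar> * (K + \<bar>B n\<bar>) = \<bar>k2\<bar> * K + \<bar>k2\<bar> * \<bar>B n\<bar>"
        by (rule distrib_left)
      ultimately show ?thesis by linarith
    qed
    finally show ?thesis .
  qed
  have LM: "L n \<le> L 0 * M ^ n" for n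
  proof (induction n)
    case (Suc n)
    have "L (Suc n) \<le> M * (L 0 * M ^ n)"
      using LS[of n] mult_left_mono[OF Suc M0] by linarith
    then show ?case by (simp add: mult_ac)
  qed simp
  have summ: "summable (\<lambda>n. F n / fact n * x ^ n)"
    if F: "\<And>n. \<bar>F n\<bar> \<le> L n" for F :: "nat \<Rightarrow> real" and x :: real
  proof (rule summable_comparison_test')
    show "summable (\<lambda>n. L 0 * (inverse (fact n) * (M * \<bar>x\<bar>) ^ n))"
      by (intro summable_mult summable_exp)
    show "norm (F n / fact n * x ^ n) \<le> L 0 * (inverse (fact n) * (M * \<bar>x\<bar>) ^ n)" for n
    proof -
      have "\<bar>F n\<bar> \<le> L 0 * M ^ n" using F[of n] LM[of n] by linarith
      then have "\<bar>F n\<bar> * (inverse (fact n) * \<bar>x\<bar> ^ n) \<le> L 0 * M ^ n * (inverse (fact n) * \<bar>x\<bar> ^ n)"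
        by (intro mult_right_mono) auto
      then show ?thesis
        by (simp add: abs_mult power_abs power_mult_distrib divide_inverse mult_ac)
    qed
  qed
  have sA: "summable (\<lambda>n. A n / fact n * x ^ n)" for x
    by (rule summ) (use K0 in \<open>simp add: L_def\<close>)
  have sB: "summable (\<lambda>n. B n / fact n * x ^ n)" for x
    by (rule summ) (use K0 in \<open>simp add: L_def\<close>)
  define s where "s x = (\<Sum>n. A n / fact n * x ^ n)" for x
  define v where "v x = (\<Sum>n. B n / fact n * x ^ n)" for x
  have As: "(\<lambda>n. A n / fact n * x ^ n) sums s x" for x
    unfolding s_def using sA by (rule summable_sums)
  have Bs: "(\<lambda>n. B n / fact n * x ^ n) sums v x" for x
    unfolding v_def using sB by (rule summable_sums)
  have cs: "(\<lambda>n. c n / fact n * x ^ n) sums poly p x" for x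
  proof -
    have "(\<lambda>n. coeff p n * x ^ n) sums (\<Sum>n\<le>degree p. coeff p n * x ^ n)"
      by (rule sums_finite) (auto simp: coeff_eq_0)
    then show ?thesis by (simp add: c_def poly_altdef)
  qed
  have dif: "diffs (\<lambda>n. F n / fact n) n = F (Suc n) / fact n" for F :: "nat \<Rightarrow> real" and n
    by (simp add: diffs_def field_simps del: of_nat_Suc)
  have ds: "(s has_real_derivative (poly p t - v t)) (at t)" for t
  proof -
    have "(\<lambda>n. c n / fact n * t ^ n - B n / fact n * t ^ n) sums (poly p t - v t)"
      by (intro sums_diff cs Bs)
    then have "(\<lambda>n. diffs (\<lambda>n. A n / fact n) n * t ^ n) sums (poly p t - v t)"
      by (simp add: dif AS diff_divide_distrib left_diff_distrib)
    then have "(\<Sum>n. diffs (\<lambda>n. A n / fact n) n * t ^ n) = poly p t - v t"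
      by (rule sums_unique[symmetric])
    then show ?thesis
      using termdiffs_strong_converges_everywhere[of "\<lambda>n. A n / fact n" t, OF sA]
      by (simp add: s_def[abs_def])
  qed
  have dv: "(v has_real_derivative (k1 * (s t - \<tau> * v t) + k2 * (poly p t - v t))) (at t)" for t
  proof -
    have "(\<lambda>n. k1 * (A n / fact n * t ^ n - \<tau> * (B n / fact n * t ^ n))
               + k2 * (c n / fact n * t ^ n - B n / fact n * t ^ n))
          sums (k1 * (s t - \<tau> * v t) + k2 * (poly p t - v t))"
      by (intro sums_add sums_mult sums_diff cs As Bs)
    also have "(\<lambda>n. k1 * (A n / fact n * t ^ n - \<tau> * (B n / fact n * t ^ n))
               + k2 * (c n / fact n * t ^ n - B n / fact n * t ^ n))
        = (\<lambda>n. diffs (\<lambda>n. B n / fact n) n * t ^ n)"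
      by (rule ext) (simp add: dif BS field_simps)
    finally have "(\<Sum>n. diffs (\<lambda>n. B n / fact n) n * t ^ n)
        = k1 * (s t - \<tau> * v t) + k2 * (poly p t - v t)"
      by (rule sums_unique[symmetric])
    then show ?thesis
      using termdiffs_strong_converges_everywhere[of "\<lambda>n. B n / fact n" t, OF sB]
      by (simp add: v_def[abs_def])
  qed
  have "s 0 = s0" "v 0 = v0"
    using powser_zero[of "\<lambda>n. A n / fact n"] powser_zero[of "\<lambda>n. B n / fact n"]
    by (simp_all add: s_def v_def A0 B0)
  then have "cth_rv_solution \<theta> x0 (poly p) s v"
    using ds dv by (auto simp: cth_rv_solution_def th x0 intro: has_field_derivative_at_within)
  then show ?thesis by blast
qed

lemma cth_rv_solution_unique:
  assumes sol1: "cth_rv_solution \<theta> x0 u s1 v1" and sol2: "cth_rv_solution \<theta> x0 u s2 v2"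
    and t: "t \<ge> 0"
  shows "s1 t = s2 t \<and> v1 t = v2 t"
proof -
  obtain k1 k2 \<tau> where th: "\<theta> = (k1, k2, \<tau>)" by (cases \<theta>) auto
  obtain s0 v0 where x0: "x0 = (s0, v0)" by (cases x0) auto
  define e where "e r = s1 r - s2 r" for r
  define f where "f r = v1 r - v2 r" for r
  define c where "c = k1 * \<tau> + k2"
  define L where "L = 1 + \<bar>k1\<bar> + 2 * \<bar>c\<bar>"
  have z: "e 0 = 0" "f 0 = 0"
    using sol1 sol2 by (auto simp: cth_rv_solution_def th x0 e_def f_def)
  have de: "(e has_real_derivative (- f r)) (at r within {0..})" if "r \<ge> 0" for r
  proof -
    have "((\<lambda>r. s1 r - s2 r) has_real_derivative ((u r - v1 r) - (u r - v2 r))) (at r within {0..})"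
      using sol1 sol2 that by (intro DERIV_diff) (auto simp: cth_rv_solution_def th x0)
    then show ?thesis by (simp add: e_def[abs_def] f_def)
  qed
  have df: "(f has_real_derivative (k1 * e r - c * f r)) (at r within {0..})" if "r \<ge> 0" for r
  proof -
    have "((\<lambda>r. v1 r - v2 r) has_real_derivative
        ((k1 * (s1 r - \<tau> * v1 r) + k2 * (u r - v1 r)) - (k1 * (s2 r - \<tau> * v2 r) + k2 * (u r - v2 r))))
        (at r within {0..})"
      using sol1 sol2 that by (intro DERIV_diff) (auto simp: cth_rv_solution_def th x0)
    also have "(k1 * (s1 r - \<tau> * v1 r) + k2 * (u r - v1 r)) - (k1 * (s2 r - \<tau> * v2 r) + k2 * (u r - v2 r))
        = k1 * e r - c * f r"
      by (simp add: e_def f_def c_def algebra_simps)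
    finally show ?thesis by (simp add: f_def[abs_def])
  qed
  define w where "w r = ((e r)\<^sup>2 + (f r)\<^sup>2) * exp (- L * r)" for r
  define w' where "w' r = (2 * e r * (- f r) + 2 * f r * (k1 * e r - c * f r)
      - L * ((e r)\<^sup>2 + (f r)\<^sup>2)) * exp (- L * r)" for r
  have dw: "(w has_real_derivative w' r) (at r within {0..})" if "r \<ge> 0" for r
    unfolding w_def[abs_def] w'_def
    by (rule derivative_eq_intros de[OF that] df[OF that] refl | simp add: algebra_simps)+
  have neg: "w' r \<le> 0" for r
  proof -
    have ef: "2 * \<bar>e r * f r\<bar> \<le> (e r)\<^sup>2 + (f r)\<^sup>2"
      using sum_squares_bound[of "\<bar>e r\<bar>" "\<bar>f r\<bar>"] by (simp add: abs_mult mult.assoc)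
    have "2 * e r * (- f r) + 2 * f r * (k1 * e r - c * f r)
        = 2 * ((k1 - 1) * (e r * f r)) - 2 * c * (f r)\<^sup>2"
      by (simp add: algebra_simps power2_eq_square)
    also have "\<dots> \<le> (1 + \<bar>k1\<bar>) * (2 * \<bar>e r * f r\<bar>) + 2 * \<bar>c\<bar> * (f r)\<^sup>2"
    proof -
      have "(k1 - 1) * (e r * f r) \<le> \<bar>k1 - 1\<bar> * \<bar>e r * f r\<bar>"
        by (metis abs_ge_self abs_mult)
      also have "\<dots> \<le> (1 + \<bar>k1\<bar>) * \<bar>e r * f r\<bar>" by (intro mult_right_mono) auto
      finally have 1: "(k1 - 1) * (e r * f r) \<le> (1 + \<bar>k1\<bar>) * \<bar>e r * f r\<bar>" .
      have 2: "- c * (f r)\<^sup>2 \<le> \<bar>c\<bar> * (f r)\<^sup>2" by (intro mult_right_mono) auto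
      show ?thesis using 1 2 by simp
    qed
    also have "\<dots> \<le> (1 + \<bar>k1\<bar>) * ((e r)\<^sup>2 + (f r)\<^sup>2) + 2 * \<bar>c\<bar> * ((e r)\<^sup>2 + (f r)\<^sup>2)"
      by (intro add_mono mult_left_mono ef) auto
    also have "\<dots> = L * ((e r)\<^sup>2 + (f r)\<^sup>2)" by (simp add: L_def algebra_simps)
    finally show ?thesis unfolding w'_def by (intro mult_nonpos_nonneg) auto
  qed
  have "w t \<le> w 0"
  proof (cases "t = 0")
    case False
    with t have "0 < t" by simp
    moreover have "(w has_derivative (\<lambda>h. w' r * h)) (at r within {0..t})" if "0 \<le> r" "r \<le> t" for r
    proof -
      have "(w has_real_derivative w' r) (at r within {0..t})"
        by (rule DERIV_subset[OF dw]) (use that in auto)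
      then show ?thesis by (simp add: has_field_derivative_def)
    qed
    ultimately obtain r where "w t - w 0 = w' r * (t - 0)"
      using mvt_very_simple[of 0 t w "\<lambda>r h. w' r * h"] by auto
    with neg[of r] t show ?thesis
      by (metis diff_le_0_iff_le diff_zero mult_nonpos_nonneg)
  qed simp
  then have "((e t)\<^sup>2 + (f t)\<^sup>2) * exp (- L * t) \<le> 0" by (simp add: w_def z)
  then have "(e t)\<^sup>2 + (f t)\<^sup>2 \<le> 0" by (simp add: mult_le_0_iff)
  then have "e t = 0 \<and> f t = 0"
    by (simp add: sum_power2_le_zero_iff)
  then show ?thesis by (simp add: e_def f_def)
qed

lemma cth_rv_output_unique:
  assumes "t \<ge> 0"
  shows "\<exists>!y. \<exists>s v. cth_rv_solution \<theta> x0 (poly p) s v \<and> y = s t"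
  using cth_rv_solution_exists cth_rv_solution_unique[OF _ _ assms] by blast

lemma cth_rv_output_eq:
  assumes "cth_rv_solution \<theta> x0 (poly p) s v" "t \<ge> 0"
  shows "cth_rv_output t \<theta> x0 (poly p) = s t"
  unfolding cth_rv_output_def
  using cth_rv_output_unique[OF assms(2), of \<theta> x0 p] assms(1) by (intro the1_equality) blast+

end

theory Submission
  imports Defs
begin

text \<open>If \<open>\<tau> k2 = 1\<close> then \<open>w = s - \<tau> v\<close> satisfies \<open>w' = - \<tau> k1 w\<close>, and \<open>s0 = \<tau> v0\<close> says
  \<open>w 0 = 0\<close>. So \<open>w\<close> vanishes identically, the gain \<open>k1\<close> drops out of the dynamics, and changing
  \<open>k1\<close> alone does not affect the output.\<close>

lemma cth_rv_solution_gain_irrelevant: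
  assumes sol: "cth_rv_solution (0, k2, \<tau>) (s0, v0) u s v"
    and "\<tau> * k2 = 1" and "s0 = \<tau> * v0"
  shows "cth_rv_solution (k1, k2, \<tau>) (s0, v0) u s v"
proof -
  \<comment> \<open>Starting from gain \<open>0\<close> makes the right-hand side of the equation
    for \<open>w\<close> zero, so \<open>w\<close> is constant at once and no linear ODE has to be
    solved.\<close>
  have "((\<lambda>t. s t - \<tau> * v t) has_real_derivative 0) (at t within {0..})" if "t \<in> {0..}" for t
  proof -
    have "((\<lambda>t. s t - \<tau> * v t) has_real_derivative (u t - v t) - \<tau> * (k2 * (u t - v t)))
        (at t within {0..})"
      using sol that by (intro DERIV_diff DERIV_cmult) (auto simp: cth_rv_solution_def)
    moreover have "\<tau> * (k2 * (u t - v t)) = u t - v t"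
      unfolding mult.assoc[symmetric] assms(2) by simp
    ultimately show ?thesis
      by simp
  qed
  then have "\<exists>c. \<forall>t\<in>{0..}. s t - \<tau> * v t = c"
    by (rule has_field_derivative_zero_constant[OF convex_real_interval(1)])
  then obtain c where c: "s t - \<tau> * v t = c" if "t \<ge> 0" for t
    by auto
  have "s 0 - \<tau> * v 0 = 0"
    using sol assms(3) unfolding cth_rv_solution_def by simp
  with c[of 0] have "c = 0"
    by simp
  then have "s t - \<tau> * v t = 0" if "t \<ge> 0" for t
    using c[OF that] by simp
  \<comment> \<open>On \<open>t \<ge> 0\<close> the feedback terms with gains \<open>0\<close> and
    \<open>k1\<close> are both zero, so the two systems prescribe the same derivatives along this
    trajectory.\<close>
  with sol show ?thesis
    unfolding cth_rv_solution_def case_prod_conv by (metis mult_zero_left mult_zero_right)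
qed

text \<open>A single trajectory, taken at gain \<open>0\<close>, solves the system for every gain;
  by uniqueness of solutions it gives the output for each of them.\<close>

lemma cth_rv_output_gain_irrelevant:
  assumes "\<tau> * k2 = 1" and "s0 = \<tau> * v0" and "t \<ge> 0"
  shows "cth_rv_output t (k1, k2, \<tau>) (s0, v0) (poly p)
    = cth_rv_output t (k1', k2, \<tau>) (s0, v0) (poly p)"
proof -
  obtain s v where "cth_rv_solution (0, k2, \<tau>) (s0, v0) (poly p) s v"
    using cth_rv_solution_exists by blast
  then have "cth_rv_output t (k, k2, \<tau>) (s0, v0) (poly p) = s t" for k
    using assms by (intro cth_rv_output_eq[OF cth_rv_solution_gain_irrelevant])
  then show ?thesis by simp
qed

text \<open>The gain is moved upwards because this stays in \<open>Theta\<close> even from the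
  boundary \<open>k1 = 0\<close>.\<close>

lemma param_neighborhood_contains_larger_gain:
  assumes "param_neighborhood N (k1, k2, \<tau>)"
  obtains k1' where "k1 < k1'" and "(k1', k2, \<tau>) \<in> N"
proof -
  obtain T where T: "open T" "(k1, k2, \<tau>) \<in> T" "T \<inter> Theta \<subseteq> N"
    and Theta: "(k1, k2, \<tau>) \<in> Theta"
    using assms unfolding param_neighborhood_def openin_open by blast
  \<comment> \<open>Slicing \<open>T\<close> along the \<open>k1\<close> axis reduces the search to
    an interval around \<open>k1\<close>.\<close>
  have "open ((\<lambda>k. (k, k2, \<tau>)) -` T)"
    using T(1) by (intro open_vimage continuous_intros)
  then obtain e where e: "e > 0" "\<And>k. dist k k1 < e \<Longrightarrow> (k, k2, \<tau>) \<in> T"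
    using T(2) unfolding open_dist by auto
  show thesis
  proof
    show "k1 < k1 + e / 2"
      using e(1) by simp
    have "(k1 + e / 2, k2, \<tau>) \<in> T"
      using e by (simp add: dist_real_def)
    moreover have "(k1 + e / 2, k2, \<tau>) \<in> Theta"
      using Theta e(1) by (simp add: Theta_def)
    ultimately show "(k1 + e / 2, k2, \<tau>) \<in> N"
      using T(3) by blast
  qed
qed

theorem proposition3:
  fixes s0 v0 k1 k2 \<tau> :: real
  assumes "s0 \<noteq> 0" and "v0 \<noteq> 0"
    and "(k1, k2, \<tau>) \<in> Theta"
    and "\<tau> = s0 / v0" and "k2 = v0 / s0"
  shows "(\<nexists>u. admissible_input (k1, k2, \<tau>) (s0, v0) u) \<and>
    (\<forall>p :: real poly. \<forall>N. param_neighborhood N (k1, k2, \<tau>) \<longrightarrow>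
       (\<exists>\<theta>1\<in>N. \<exists>\<theta>2\<in>N. \<theta>1 \<noteq> \<theta>2 \<and>
          (\<forall>t>0. cth_rv_output t \<theta>1 (s0, v0) (poly p) = cth_rv_output t \<theta>2 (s0, v0) (poly p))))"
proof -
  have "\<exists>\<theta>1\<in>N. \<exists>\<theta>2\<in>N. \<theta>1 \<noteq> \<theta>2 \<and>
      (\<forall>t>0. cth_rv_output t \<theta>1 (s0, v0) (poly p) = cth_rv_output t \<theta>2 (s0, v0) (poly p))"
    if N: "param_neighborhood N (k1, k2, \<tau>)" for p N
  proof -
    obtain k1' where k1': "k1 < k1'" "(k1', k2, \<tau>) \<in> N"
      using param_neighborhood_contains_larger_gain[OF N] .
    have "(k1, k2, \<tau>) \<in> N"
      using N unfolding param_neighborhood_def by blast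
    moreover have "(k1, k2, \<tau>) \<noteq> (k1', k2, \<tau>)"
      using k1'(1) by simp
    moreover have "cth_rv_output t (k1, k2, \<tau>) (s0, v0) (poly p)
        = cth_rv_output t (k1', k2, \<tau>) (s0, v0) (poly p)" if "t > 0" for t
      using assms that by (intro cth_rv_output_gain_irrelevant) simp_all
    ultimately show ?thesis
      using k1'(2) by blast
  qed
  \<comment> \<open>An admissible input is some \<open>poly p\<close>, and the pair found in each
    \<open>N\<close> refutes local identifiability.\<close>
  then show ?thesis
    unfolding admissible_input_def locally_identifiable_def by blast
qed

end
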